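(* Let $1<p<\infty$ and $n\in\mathbb{N}$. Suppose that $f\in H^p$ has inner part $J$, with $J(0)\ne0$. Let $w_1,\dots,w_k$ be the roots (counting multiplicities) of $q_{n,p}[f]$ in $\mathbb{D}$. Then $$|w_1\cdots w_k|\ge\frac{\left(1-\|1-q_{n,p}[f]f\|_p^p\right)^{1/2}}{|J(0)|}.$$
   Context: $\mathbb{N}=\{0,1,2,\dots\}$ and $\mathbb{D}$ is the open unit disk. $H^p$ is the Hardy space of analytic functions on $\mathbb{D}$ with norm $\|f\|_p^p=\sup_{0<r<1}\frac1{2\pi}\int_0^{2\pi}|f(re^{i\theta})|^p\,d\theta$. Every nonzero $f\in H^p$ factors as $f=JF$ with $J$ inner (bounded analytic with boundary values of modulus $1$ a.e.) and $F$ outer; $J$ is its inner part, unique up to a unimodular constant. $\mathcal{P}_n$ is the set of complex polynomials of degree at most $n$. For $f\in H^p$ with $f(0)\ne0$, the $n$-th optimal polynomial approximant $q_{n,p}[f]$ to $1/f$ in $H^p$ is the unique element of $\mathcal{P}_n$ with $\|1-q_{n,p}[f]f\|_p=\inf_{q\in\mathcal{P}_n}\|1-qf\|_p$. An empty product (no roots in $\mathbb{D}$) equals $1$. *)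

theory Defs
  imports "HOL-Complex_Analysis.Complex_Analysis" "HOL-Computational_Algebra.Computational_Algebra"
begin

text \<open>Functions on the open unit disk are represented by total functions on the complex
  plane; only their values on \<open>ball 0 1\<close> matter.\<close>

definition hardy_mean :: "real \<Rightarrow> (complex \<Rightarrow> complex) \<Rightarrow> real \<Rightarrow> real" where
  "hardy_mean p f r =
     1 / (2 * pi) * (LINT \<theta>:{0..2*pi}|lborel. norm (f (of_real r * cis \<theta>)) powr p)"

definition hardy_space :: "real \<Rightarrow> (complex \<Rightarrow> complex) set" where
  "hardy_space p =
     {f. f holomorphic_on ball 0 1 \<and> bdd_above (hardy_mean p f ` {0<..<1})}"

text \<open>Meaningful only for members of \<open>hardy_space p\<close>, where the supremum is finite.\<close>

definition hardy_norm :: "real \<Rightarrow> (complex \<Rightarrow> complex) \<Rightarrow> real" where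
  "hardy_norm p f = (SUP r\<in>{0<..<1}. hardy_mean p f r) powr (1 / p)"

text \<open>Boundary values are radial limits.\<close>

definition inner_function :: "(complex \<Rightarrow> complex) \<Rightarrow> bool" where
  "inner_function J \<longleftrightarrow>
     J holomorphic_on ball 0 1 \<and> bounded (J ` ball 0 1) \<and>
     (AE \<theta>\<in>{0..2*pi} in lborel.
        \<exists>\<zeta>. norm \<zeta> = 1 \<and> ((\<lambda>r. J (of_real r * cis \<theta>)) \<longlongrightarrow> \<zeta>) (at_left 1))"

text \<open>The function \<open>u\<close> is the logarithm of the prescribed boundary modulus. Working with
  \<open>u\<close> itself avoids the convention \<open>ln 0 = 0\<close>.\<close>

definition outer_function :: "(complex \<Rightarrow> complex) \<Rightarrow> bool" where
  "outer_function F \<longleftrightarrow>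
     (\<exists>(c::complex) (u::real \<Rightarrow> real).
        norm c = 1 \<and> set_integrable lborel {0..2*pi} u \<and>
        (\<forall>z\<in>ball 0 1.
           F z = c * exp (1 / of_real (2 * pi) *
             (LINT \<theta>:{0..2*pi}|lborel. (cis \<theta> + z) / (cis \<theta> - z) * of_real (u \<theta>)))))"

definition inner_part :: "real \<Rightarrow> (complex \<Rightarrow> complex) \<Rightarrow> (complex \<Rightarrow> complex) \<Rightarrow> bool" where
  "inner_part p f J \<longleftrightarrow>
     inner_function J \<and>
     (\<exists>F\<in>hardy_space p. outer_function F \<and> (\<forall>z\<in>ball 0 1. f z = J z * F z))"

text \<open>\<open>q\<close> is the \<open>n\<close>-th optimal polynomial approximant to \<open>1 / f\<close>. For \<open>1 < p\<close> and
  \<open>f \<in> hardy_space p\<close> with \<open>f 0 \<noteq> 0\<close> there is exactly one such \<open>q\<close>.\<close>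

definition optimal_poly_approximant ::
    "nat \<Rightarrow> real \<Rightarrow> (complex \<Rightarrow> complex) \<Rightarrow> complex poly \<Rightarrow> bool" where
  "optimal_poly_approximant n p f q \<longleftrightarrow>
     degree q \<le> n \<and>
     hardy_norm p (\<lambda>z. 1 - poly q z * f z) =
       (INF h\<in>{h. degree h \<le> n}. hardy_norm p (\<lambda>z. 1 - poly h z * f z))"

end

theory Submission
  imports Defs
begin

text \<open>
  The product of the roots of \<open>q\<close> in the disk is, up to sign, the value at 0 of the Blaschke
  product \<open>W\<close> with these roots, and \<open>q = W * Q\<close> for a polynomial \<open>Q\<close>
  (\<open>poly_inner_decomposition\<close>). With \<open>f = J * F\<close> the product \<open>q * f\<close> equals \<open>I * g\<close>, where
  \<open>I = J * W\<close> is inner and \<open>g = Q * F\<close> lies in \<open>H\<^sup>p\<close>. Hence \<open>norm (1 - q f)\<close> is at least the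
  distance from 1 to \<open>I * H\<^sup>p\<close>, and the theorem follows from the estimate
  \<open>1 - (norm (I 0))\<^sup>2 \<le> (norm (1 - I g)) powr p\<close>
  for every inner \<open>I\<close> and every \<open>g\<close> in \<open>H\<^sup>p\<close> (\<open>hardy_norm_one_minus_inner_mult_ge\<close>).

  For \<open>p = 2\<close> this is orthogonal projection: the component of 1 orthogonal to \<open>I * H\<^sup>2\<close> is the
  kernel \<open>K = 1 - cnj (I 0) * I\<close>, whose squared norm is \<open>1 - (norm (I 0))\<^sup>2\<close>. For general \<open>p\<close>
  the role of \<open>K\<close> as a competitor is taken by \<open>K powr (2 / p)\<close>, which again is congruent to 1
  modulo \<open>I\<close> and whose \<open>p\<close>-th power has modulus \<open>(norm K)\<^sup>2\<close>. Young's inequality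
  (\<open>Young_weighted\<close>) compares \<open>1 - I g\<close> with this function, and the reproducing
  property of \<open>K\<close> (\<open>circle_mean_kernel_tendsto\<close>) evaluates the resulting linear term.

  The boundary integrals of this argument are replaced by limits of means over circles of radius
  \<open>r < 1\<close>. What remains of the boundary behaviour of \<open>I\<close> is that the means of
  \<open>1 - (norm (I z))\<^sup>2\<close> tend to 0, which follows from dominated convergence, and that this
  persists after multiplication by a function in \<open>H\<^sup>p\<close> because \<open>p > 1\<close>
  (\<open>circle_mean_inner_defect_tendsto\<close>).
\<close>

section \<open>Means over circles\<close>

definition circle_mean :: "(complex \<Rightarrow> 'a::{banach, second_countable_topology}) \<Rightarrow> real \<Rightarrow> 'a" where
  "circle_mean f r = (1 / (2 * pi)) *\<^sub>R (LINT \<theta>:{0..2*pi}|lborel. f (of_real r * cis \<theta>))"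

lemma hardy_mean_eq_circle_mean: "hardy_mean p f = circle_mean (\<lambda>z. norm (f z) powr p)"
  by (simp add: fun_eq_iff hardy_mean_def circle_mean_def)

lemma circle_integrable:
  fixes f :: "complex \<Rightarrow> 'a::{banach, second_countable_topology}"
  assumes "continuous_on (sphere 0 r) f" "0 < r"
  shows "set_integrable lborel {0..2*pi} (\<lambda>\<theta>. f (of_real r * cis \<theta>))"
proof (rule borel_integrable_atLeastAtMost')
  show "continuous_on {0..2*pi} (\<lambda>\<theta>. f (of_real r * cis \<theta>))"
    by (rule continuous_on_compose2[OF assms(1)])
       (use assms(2) in \<open>auto intro!: continuous_intros simp: norm_mult\<close>)
qed

lemma continuous_on_sphere_of_ball:
  assumes "continuous_on (ball 0 1) f" "r < 1"
  shows "continuous_on (sphere (0::complex) r) f"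
  by (rule continuous_on_subset[OF assms(1)]) (use assms(2) in auto)

lemma circle_mean_add:
  fixes f :: "complex \<Rightarrow> 'a::{banach, second_countable_topology}"
  assumes "continuous_on (sphere 0 r) f" "continuous_on (sphere 0 r) g" "0 < r"
  shows "circle_mean (\<lambda>z. f z + g z) r = circle_mean f r + circle_mean g r"
  using assms by (simp add: circle_mean_def circle_integrable set_integral_add scaleR_add_right)

lemma circle_mean_diff:
  fixes f :: "complex \<Rightarrow> 'a::{banach, second_countable_topology}"
  assumes "continuous_on (sphere 0 r) f" "continuous_on (sphere 0 r) g" "0 < r"
  shows "circle_mean (\<lambda>z. f z - g z) r = circle_mean f r - circle_mean g r"
  using assms by (simp add: circle_mean_def circle_integrable set_integral_diff scaleR_diff_right)

lemma circle_mean_mult_left: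
  fixes c :: "'a::{real_normed_field, banach, second_countable_topology}"
  shows "circle_mean (\<lambda>z. c * f z) r = c * circle_mean f r"
  by (simp add: circle_mean_def)

lemma circle_mean_const [simp]: "circle_mean (\<lambda>z. c) r = c"
  by (simp add: circle_mean_def set_lebesgue_integral_def)

lemma circle_mean_cnj: "circle_mean (\<lambda>z. cnj (f z)) r = cnj (circle_mean f r)"
proof -
  have "(\<lambda>x. indicat_real {0..2*pi} x *\<^sub>R cnj (f (of_real r * cis x))) =
        (\<lambda>x. cnj (indicat_real {0..2*pi} x *\<^sub>R f (of_real r * cis x)))"
    by (simp add: fun_eq_iff)
  then have "(LINT x|lborel. indicat_real {0..2*pi} x *\<^sub>R cnj (f (of_real r * cis x))) =
        cnj (LINT x|lborel. indicat_real {0..2*pi} x *\<^sub>R f (of_real r * cis x))"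
    by (simp only: Bochner_Integration.integral_cnj)
  then show ?thesis
    by (simp only: circle_mean_def set_lebesgue_integral_def complex_cnj_scaleR)
qed

lemma circle_mean_of_real: "circle_mean (\<lambda>z. of_real (f z) :: complex) r
  = of_real (circle_mean f r)"
  unfolding circle_mean_def by (subst set_integral_complex_of_real) (simp add: scaleR_conv_of_real)

lemma circle_mean_cong:
  assumes "0 < r" "\<And>z. norm z = r \<Longrightarrow> f z = g z"
  shows "circle_mean f r = circle_mean g r"
  unfolding circle_mean_def
  by (rule arg_cong[where f="\<lambda>x. _ *\<^sub>R x"], rule set_lebesgue_integral_cong)
    (use assms in \<open>auto simp: norm_mult\<close>)

lemma circle_mean_mono:
  fixes f g :: "complex \<Rightarrow> real"
  assumes "continuous_on (sphere 0 r) f" "continuous_on (sphere 0 r) g" "0 < r"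
    and "\<And>z. norm z = r \<Longrightarrow> f z \<le> g z"
  shows "circle_mean f r \<le> circle_mean g r"
proof -
  have "(LINT \<theta>:{0..2*pi}|lborel. f (of_real r * cis \<theta>))
    \<le> (LINT \<theta>:{0..2*pi}|lborel. g (of_real r * cis \<theta>))"
    by (rule set_integral_mono) (use assms in \<open>auto intro: circle_integrable simp: norm_mult\<close>)
  then show ?thesis by (simp add: circle_mean_def divide_right_mono)
qed

lemma norm_circle_mean_le:
  fixes f :: "complex \<Rightarrow> 'a::{banach, second_countable_topology}"
  assumes "continuous_on (sphere 0 r) f" "0 < r"
  shows "norm (circle_mean f r) \<le> circle_mean (\<lambda>z. norm (f z)) r"
  using set_integral_norm_bound[OF circle_integrable[OF assms]]
  by (simp add: circle_mean_def divide_right_mono)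

text \<open>Cauchy's formula in the form adapted to circle means: on \<open>w = r * cis \<theta>\<close> one has
  \<open>dw = \<i> * w * d\<theta>\<close>, which accounts for the factor \<open>w\<close>.\<close>

lemma circle_mean_Cauchy:
  assumes "f holomorphic_on ball 0 1" "norm z < r" "r < 1"
  shows "circle_mean (\<lambda>w. w / (w - z) * f w) r = f z"
proof -
  have r: "0 < r" using assms(2) norm_ge_zero[of z] by linarith
  have ne: "w \<noteq> z" if "norm w = r" for w using that assms by auto
  have cf: "continuous_on (sphere 0 r) f"
    using assms holomorphic_on_imp_continuous_on continuous_on_sphere_of_ball by blast
  have hol: "f holomorphic_on cball 0 r"
    by (rule holomorphic_on_subset[OF assms(1)]) (use assms(3) in auto)
  have "((\<lambda>u. f u / (u - z)) has_contour_integral (2 * of_real pi * \<i> * f z))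
    (part_circlepath 0 r 0 (2*pi))"
    using Cauchy_integral_circlepath_simple[OF hol, of z] assms(2) by (simp add: circlepath_def)
  then have "((\<lambda>t. f (0 + r * cis t) / (0 + r * cis t - z) * r * \<i> * cis t)
    has_integral (2 * of_real pi * \<i> * f z)) {0..2*pi}"
    by (subst (asm) has_contour_integral_part_circlepath_iff) auto
  then have I: "((\<lambda>t. \<i> * (r * cis t / (r * cis t - z) * f (r * cis t))) has_integral
    (2 * of_real pi * \<i> * f z)) {0..2*pi}"
    by (simp add: field_simps)
  have "(-\<i>) * (\<i> * x) = x" for x :: complex
    by (simp flip: mult.assoc)
  moreover have "(-\<i>) * (2 * of_real pi * \<i> * f z) = 2 * of_real pi * f z"
    by (simp add: algebra_simps)
  ultimately have I2: "((\<lambda>t. r * cis t / (r * cis t - z) * f (r * cis t)) has_integral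
    (2 * of_real pi * f z)) {0..2*pi}"
    using has_integral_mult_right[OF I, of "-\<i>"] by (simp only:)
  have "set_integrable lborel {0..2*pi} (\<lambda>t. r * cis t / (r * cis t - z) * f (r * cis t))"
    by (rule circle_integrable[of r "\<lambda>w. w / (w - z) * f w"])
      (use ne r cf in \<open>auto intro!: continuous_intros\<close>)
  from set_borel_integral_eq_integral(2)[OF this] I2
  show ?thesis by (simp add: circle_mean_def integral_unique scaleR_conv_of_real)
qed

lemma circle_mean_holomorphic:
  assumes "f holomorphic_on ball 0 1" "0 < r" "r < 1"
  shows "circle_mean f r = f 0"
proof -
  have "circle_mean f r = circle_mean (\<lambda>w. w / (w - 0) * f w) r"
    by (rule circle_mean_cong) (use assms in auto)
  also have "\<dots> = f 0" by (rule circle_mean_Cauchy) (use assms in auto)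
  finally show ?thesis .
qed

text \<open>Dominated convergence, with the radial limit prescribed to be the same constant for almost
  every angle. This is the only way in which boundary values enter the argument: all integrals
  are taken over circles of radius less than 1, where everything is continuous.\<close>

lemma circle_mean_tendsto:
  fixes u :: "complex \<Rightarrow> real"
  assumes cont: "continuous_on (ball 0 1) u" and bd: "\<And>z. z \<in> ball 0 1 \<Longrightarrow> \<bar>u z\<bar> \<le> B"
    and lim: "AE \<theta>\<in>{0..2*pi} in lborel. ((\<lambda>r. u (of_real r * cis \<theta>)) \<longlongrightarrow> c) (at_left 1)"
  shows "(circle_mean u \<longlongrightarrow> c) (at_left 1)"
proof -
  have "((\<lambda>r. LINT \<theta>:{0..2*pi}|lborel. u (of_real r * cis \<theta>))
    \<longlongrightarrow> (LINT \<theta>:{0..2*pi}|lborel. c)) (at_left 1)"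
  proof (rule tendsto_at_left_sequentially[of 0])
    fix S :: "nat \<Rightarrow> real"
    assume S: "\<And>n. S n < 1" "\<And>n. 0 < S n" "S \<longlonglongrightarrow> 1"
    have fl: "filterlim S (at_left 1) sequentially"
      using S by (auto simp: filterlim_at less_imp_neq)
    have int: "set_integrable lborel {0..2*pi} (\<lambda>\<theta>. u (of_real (S n) * cis \<theta>))" for n
      by (rule circle_integrable) (use S cont continuous_on_sphere_of_ball in auto)
    show "(\<lambda>n. LINT \<theta>:{0..2*pi}|lborel. u (of_real (S n) * cis \<theta>)) \<longlonglongrightarrow> (LINT \<theta>:{0..2*pi}|lborel. c)"
      unfolding set_lebesgue_integral_def
    proof (rule integral_dominated_convergence[where w="\<lambda>\<theta>. indicator {0..2*pi} \<theta> *\<^sub>R B"])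
      show "(\<lambda>x. indicat_real {0..2 * pi} x *\<^sub>R u (of_real (S i) * cis x))
          \<in> borel_measurable lborel" for i
        using int[of i] by (simp add: set_integrable_def)
      show "integrable lborel (\<lambda>\<theta>. indicat_real {0..2 * pi} \<theta> *\<^sub>R B)"
        by (intro integrable_scaleR_left) auto
      show "AE x in lborel. (\<lambda>i. indicat_real {0..2 * pi} x *\<^sub>R u (complex_of_real (S i) * cis x))
        \<longlonglongrightarrow> indicat_real {0..2 * pi} x *\<^sub>R c"
        using lim
      proof eventually_elim
        case (elim x)
        show ?case
        proof (cases "x \<in> {0..2*pi}")
          case True
          with elim have "((\<lambda>r. u (of_real r * cis x)) \<longlongrightarrow> c) (at_left 1)" by simp
          from filterlim_compose[OF this fl] True show ?thesis by simp
        qed auto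
      qed
      show "AE x in lborel. norm (indicat_real {0..2 * pi} x *\<^sub>R u (of_real (S i) * cis x))
          \<le> indicat_real {0..2 * pi} x *\<^sub>R B" for i
        using S(1,2)[of i] bd by (intro AE_I2) (auto simp: indicator_def norm_mult)
    qed auto
  qed auto
  then have "((\<lambda>r. (1 / (2*pi)) *\<^sub>R (LINT \<theta>:{0..2*pi}|lborel. u (of_real r * cis \<theta>)))
    \<longlongrightarrow> (1 / (2*pi)) *\<^sub>R (LINT \<theta>:{0..2*pi}|lborel. c)) (at_left 1)"
    by (intro tendsto_intros)
  then show ?thesis
    using circle_mean_const[where c=c and r=0] by (simp only: circle_mean_def[abs_def])
qed

section \<open>Inner functions are bounded by 1\<close>

text \<open>A weak form of the maximum principle, made sharp by taking powers: Cauchy's formula for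
  \<open>J ^ m\<close>, followed by \<open>r \<rightarrow> 1\<close>, gives \<open>norm (J z) ^ m \<le> 1 / (1 - norm z)\<close> with a right-hand
  side that does not depend on \<open>m\<close>. So \<open>norm (J z)\<close> cannot exceed 1.\<close>

lemma norm_inner_function_le_1:
  assumes "inner_function J" "z \<in> ball 0 1"
  shows "norm (J z) \<le> 1"
proof -
  have hol: "J holomorphic_on ball 0 1" and bdd: "bounded (J ` ball 0 1)"
    and AE: "AE \<theta>\<in>{0..2*pi} in lborel.
        \<exists>\<zeta>. norm \<zeta> = 1 \<and> ((\<lambda>r. J (of_real r * cis \<theta>)) \<longlongrightarrow> \<zeta>) (at_left 1)"
    using assms(1) by (auto simp: inner_function_def)
  obtain B where B: "\<And>w. w \<in> ball 0 1 \<Longrightarrow> norm (J w) \<le> B"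
    using bdd unfolding bounded_iff by blast
  have z: "norm z < 1" using assms(2) by simp
  have pow: "norm (J z) ^ m \<le> 1 / (1 - norm z)" for m
  proof -
    have hol_m: "(\<lambda>w. J w ^ m) holomorphic_on ball 0 1" by (intro holomorphic_intros hol)
    have c: "continuous_on (ball 0 1) (\<lambda>w. norm (J w) ^ m)"
      by (intro continuous_intros holomorphic_on_imp_continuous_on hol)
    have lim: "(circle_mean (\<lambda>w. norm (J w) ^ m) \<longlongrightarrow> 1) (at_left 1)"
    proof (rule circle_mean_tendsto[OF c])
      show "\<bar>norm (J w) ^ m\<bar> \<le> B ^ m" if "w \<in> ball 0 1" for w
        using B[OF that] by (simp add: power_mono)
      show "AE \<theta>\<in>{0..2*pi} in lborel. ((\<lambda>r. norm (J (of_real r * cis \<theta>)) ^ m) \<longlongrightarrow> 1) (at_left 1)"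
        using AE
      proof eventually_elim
        case (elim x)
        show ?case
        proof
          assume "x \<in> {0..2*pi}"
          with elim obtain \<zeta> where "norm \<zeta> = 1"
            and "((\<lambda>r. J (of_real r * cis x)) \<longlongrightarrow> \<zeta>) (at_left 1)" by blast
          then show "((\<lambda>r. norm (J (of_real r * cis x)) ^ m) \<longlongrightarrow> 1) (at_left 1)"
            by (auto intro!: tendsto_eq_intros)
        qed
      qed
    qed
    have "((\<lambda>r. r / (r - norm z) * circle_mean (\<lambda>w. norm (J w) ^ m) r)
      \<longlongrightarrow> 1 / (1 - norm z) * 1) (at_left 1)"
      using z by (intro tendsto_intros lim) auto
    moreover have "\<forall>\<^sub>F r in at_left 1. norm (J z) ^ m
      \<le> r / (r - norm z) * circle_mean (\<lambda>w. norm (J w) ^ m) r"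
      using eventually_at_left_real[OF z]
    proof eventually_elim
      case (elim r)
      then have r: "norm z < r" "r < 1" by auto
      have r0: "0 < r" using r norm_ge_zero[of z] by linarith
      have ne: "w \<noteq> z" if "norm w = r" for w using that r by auto
      have cs: "continuous_on (sphere 0 r) (\<lambda>w. J w ^ m)"
        using hol_m r holomorphic_on_imp_continuous_on continuous_on_sphere_of_ball by blast
      have cs2: "continuous_on (sphere 0 r) (\<lambda>w. w / (w - z) * J w ^ m)"
        using ne by (auto intro!: continuous_intros cs)
      have "norm (J z) ^ m = norm (circle_mean (\<lambda>w. w / (w - z) * J w ^ m) r)"
        using circle_mean_Cauchy[OF hol_m r] by (simp add: norm_power)
      also have "\<dots> \<le> circle_mean (\<lambda>w. norm (w / (w - z) * J w ^ m)) r"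
        by (rule norm_circle_mean_le[OF cs2 r0])
      also have "\<dots> \<le> circle_mean (\<lambda>w. r / (r - norm z) * norm (J w) ^ m) r"
      proof (rule circle_mean_mono)
        show "continuous_on (sphere 0 r) (\<lambda>w. r / (r - norm z) * norm (J w) ^ m)"
          using continuous_on_norm[OF cs] by (intro continuous_on_mult_left) (simp add: norm_power)
        fix w :: complex assume w: "norm w = r"
        have "r - norm z \<le> norm (w - z)" using norm_triangle_ineq2[of w z] w by simp
        then have "r / norm (w - z) \<le> r / (r - norm z)" using r r0
          by (intro divide_left_mono mult_pos_pos) auto
        then have "r / norm (w - z) * norm (J w) ^ m \<le> r / (r - norm z) * norm (J w) ^ m"
          by (intro mult_right_mono) auto
        then show "norm (w / (w - z) * J w ^ m) \<le> r / (r - norm z) * norm (J w) ^ m"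
          using w by (simp add: norm_mult norm_divide norm_power)
      qed (use cs2 r0 in \<open>auto intro!: continuous_intros\<close>)
      also have "\<dots> = r / (r - norm z) * circle_mean (\<lambda>w. norm (J w) ^ m) r"
        by (rule circle_mean_mult_left)
      finally show ?case .
    qed
    ultimately show ?thesis
      using tendsto_lowerbound by fastforce
  qed
  show ?thesis
  proof (rule ccontr)
    assume "\<not> ?thesis"
    then obtain m where "1 / (1 - norm z) < norm (J z) ^ m"
      using real_arch_pow[of "norm (J z)" "1 / (1 - norm z)"] by auto
    with pow[of m] show False by simp
  qed
qed

section \<open>Functions in Hardy spaces\<close>

lemma continuous_on_norm_powr:
  assumes "continuous_on S f" "0 < p"
  shows "continuous_on S (\<lambda>z. norm (f z) powr p)"
  using assms by (intro continuous_on_powr') (auto intro!: continuous_intros)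

text \<open>A substitute for uniform integrability. Because \<open>p > 1\<close>, large values of \<open>y\<close> are absorbed by
  a small multiple of \<open>y powr p\<close>; small values of \<open>y\<close> leave only a multiple of the
  weight \<open>x\<close>.\<close>

lemma mult_le_powr_add:
  fixes p \<delta> :: real
  assumes "1 < p" "0 < \<delta>"
  shows "\<exists>C. \<forall>y\<ge>0. \<forall>x\<in>{0..1}. y * x \<le> \<delta> * y powr p + C * x"
proof (intro exI allI impI ballI)
  define C where "C = (1 / \<delta>) powr (1 / (p - 1))"
  fix y x :: real assume y: "0 \<le> y" and x: "x \<in> {0..1}"
  show "y * x \<le> \<delta> * y powr p + C * x"
  proof (cases "y \<le> C")
    case True
    then have "y * x \<le> C * x" using x by (simp add: mult_right_mono)
    then show ?thesis using assms by (smt (verit) mult_nonneg_nonneg powr_ge_zero)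
  next
    case False
    have C: "0 < C" using assms by (simp add: C_def)
    then have y0: "0 < y" using False by linarith
    \<comment> \<open>\<open>C\<close> is the value of \<open>y\<close> beyond which \<open>y \<le> \<delta> * y powr p\<close>.\<close>
    have "C powr (p - 1) = 1 / \<delta>" using assms by (simp add: C_def powr_powr)
    moreover have "C powr (p - 1) \<le> y powr (p - 1)"
      using False C assms by (intro powr_mono2) auto
    ultimately have "1 / \<delta> \<le> y powr (p - 1)" by simp
    then have "1 \<le> \<delta> * y powr (p - 1)" using assms by (simp add: pos_divide_le_eq mult.commute)
    then have "y * 1 \<le> y * (\<delta> * y powr (p - 1))" using y0 by (intro mult_left_mono) auto
    also have "\<dots> = \<delta> * y powr p" using y0 by (simp add: powr_diff)
    finally have "y \<le> \<delta> * y powr p" by simp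
    moreover have "y * x \<le> y * 1" using x y by (intro mult_left_mono) auto
    moreover have "0 \<le> C * x" using C x by simp
    ultimately show ?thesis by linarith
  qed
qed

lemma zero_in_hardy_space: "(\<lambda>z. 0) \<in> hardy_space p"
  by (auto simp: hardy_space_def hardy_mean_def bdd_above_def)

text \<open>The one closure property of \<open>H\<^sup>p\<close> that is used. It covers products with bounded
  functions and the addition of bounded functions at the same time.\<close>

lemma hardy_space_dominated:
  assumes hol: "G holomorphic_on ball 0 1" and F: "F \<in> hardy_space p" and "0 < p"
    and le: "\<And>z. z \<in> ball 0 1 \<Longrightarrow> norm (G z) \<le> A * norm (F z) + B"
  shows "G \<in> hardy_space p"
proof -
  have holF: "F holomorphic_on ball 0 1" and bd: "bdd_above (hardy_mean p F ` {0<..<1})"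
    using F by (auto simp: hardy_space_def)
  obtain M where M: "\<And>r. r \<in> {0<..<1} \<Longrightarrow> hardy_mean p F r \<le> M"
    using bd unfolding bdd_above_def by blast
  define A' B' where "A' = \<bar>A\<bar>" and "B' = \<bar>B\<bar>"
  have pt: "norm (G z) powr p \<le> 2 powr p * A' powr p * norm (F z) powr p + 2 powr p * B' powr p"
    if "z \<in> ball 0 1" for z
  proof -
    have "norm (G z) \<le> A' * norm (F z) + B'"
      using le[OF that] unfolding A'_def B'_def
      by (smt (verit) mult_right_mono norm_ge_zero)
    also have "\<dots> \<le> 2 * max (A' * norm (F z)) B'" by linarith
    finally have "norm (G z) powr p \<le> (2 * max (A' * norm (F z)) B') powr p"
      using \<open>0 < p\<close> by (intro powr_mono2) auto
    also have "\<dots> \<le> 2 powr p * A' powr p * norm (F z) powr p + 2 powr p * B' powr p"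
      by (auto simp: max_def powr_mult A'_def B'_def)
    finally show ?thesis .
  qed
  have "hardy_mean p G r
    \<le> 2 powr p * A' powr p * M + 2 powr p * B' powr p" if r: "r \<in> {0<..<1}" for r
  proof -
    have sub: "sphere 0 r \<subseteq> ball (0::complex) 1" using r by auto
    have cG: "continuous_on (sphere 0 r) (\<lambda>z. norm (G z) powr p)"
      and cF: "continuous_on (sphere 0 r) (\<lambda>z. norm (F z) powr p)"
      using hol holF sub \<open>0 < p\<close>
      by (auto intro!: continuous_on_norm_powr intro: holomorphic_on_imp_continuous_on
        continuous_on_subset)
    have "hardy_mean p G r
      \<le> circle_mean (\<lambda>z. 2 powr p * A' powr p * norm (F z) powr p + 2 powr p * B' powr p) r"
      unfolding hardy_mean_eq_circle_mean
      using r by (intro circle_mean_mono cG continuous_on_add continuous_on_mult_left cF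
        continuous_on_const pt) auto
    also have "\<dots> = 2 powr p * A' powr p * hardy_mean p F r + 2 powr p * B' powr p"
      using r by (simp add: hardy_mean_eq_circle_mean circle_mean_add circle_mean_mult_left cF
        continuous_on_mult_left)
    also have "\<dots> \<le> 2 powr p * A' powr p * M + 2 powr p * B' powr p"
      using M[OF r] by (intro add_right_mono mult_left_mono) auto
    finally show ?thesis .
  qed
  then show ?thesis using hol unfolding hardy_space_def bdd_above_def by blast
qed

lemma hardy_mean_le_hardy_norm_powr:
  assumes "f \<in> hardy_space p" "0 < p" "0 < r" "r < 1"
  shows "hardy_mean p f r \<le> hardy_norm p f powr p"
proof -
  have bd: "bdd_above (hardy_mean p f ` {0<..<1})"
    using assms(1) by (auto simp: hardy_space_def)
  have le: "hardy_mean p f r \<le> (SUP r\<in>{0<..<1}. hardy_mean p f r)"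
    by (rule cSUP_upper[OF _ bd]) (use assms in auto)
  have "0 \<le> hardy_mean p f r"
    by (auto simp: hardy_mean_def set_lebesgue_integral_def intro!: divide_nonneg_nonneg
      integral_nonneg)
  with le assms(2) show ?thesis by (simp add: hardy_norm_def powr_powr)
qed

section \<open>The reproducing kernel of an inner function\<close>

lemma circle_mean_inner_tendsto:
  assumes "inner_function I"
  shows "(circle_mean (\<lambda>z. 1 - (norm (I z))\<^sup>2) \<longlongrightarrow> 0) (at_left 1)"
proof (rule circle_mean_tendsto)
  have hol: "I holomorphic_on ball 0 1"
    and AE: "AE \<theta>\<in>{0..2*pi} in lborel.
        \<exists>\<zeta>. norm \<zeta> = 1 \<and> ((\<lambda>r. I (of_real r * cis \<theta>)) \<longlongrightarrow> \<zeta>) (at_left 1)"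
    using assms by (auto simp: inner_function_def)
  show "continuous_on (ball 0 1) (\<lambda>z. 1 - (norm (I z))\<^sup>2)"
    by (intro continuous_intros holomorphic_on_imp_continuous_on hol)
  show "\<bar>1 - (norm (I z))\<^sup>2\<bar> \<le> 1" if "z \<in> ball 0 1" for z
    using norm_inner_function_le_1[OF assms that] by (simp add: power_le_one)
  show "AE \<theta>\<in>{0..2*pi} in lborel. ((\<lambda>r. 1 - (norm (I (of_real r * cis \<theta>)))\<^sup>2) \<longlongrightarrow> 0) (at_left 1)"
    using AE
  proof eventually_elim
    case (elim x)
    show ?case
    proof
      assume "x \<in> {0..2*pi}"
      with elim obtain \<zeta> where "norm \<zeta> = 1" "((\<lambda>r. I (of_real r * cis x)) \<longlongrightarrow> \<zeta>) (at_left 1)" by blast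
      then show "((\<lambda>r. 1 - (norm (I (of_real r * cis x)))\<^sup>2) \<longlongrightarrow> 0) (at_left 1)"
        by (auto intro!: tendsto_eq_intros)
    qed
  qed
qed

text \<open>This expresses that \<open>I * cnj I\<close> may be replaced by 1 under a circle mean in the limit, even
  against a possibly unbounded \<open>G\<close>. The means of \<open>norm (G z) powr p\<close> stay bounded and the
  means of the defect \<open>1 - (norm (I z))\<^sup>2\<close> tend to 0; the inequality
  \<open>mult_le_powr_add\<close> combines the two facts.\<close>

lemma circle_mean_inner_defect_tendsto:
  assumes I: "inner_function I" and G: "G \<in> hardy_space p" and "1 < p"
  shows "(circle_mean (\<lambda>z. G z * of_real (1 - (norm (I z))\<^sup>2)) \<longlongrightarrow> 0) (at_left 1)"
proof (rule tendstoI)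
  fix \<epsilon> :: real assume "0 < \<epsilon>"
  define M where "M = hardy_norm p G powr p"
  have "0 \<le> M" by (simp add: M_def)
  define \<delta> where "\<delta> = \<epsilon> / (2 * (M + 1))"
  have "0 < \<delta>" using \<open>0 < \<epsilon>\<close> \<open>0 \<le> M\<close> by (simp add: \<delta>_def)
  have "\<delta> * M \<le> \<delta> * (M + 1)" using \<open>0 < \<delta>\<close> by (intro mult_left_mono) auto
  also have "\<dots> = \<epsilon> / 2" using \<open>0 \<le> M\<close> by (simp add: \<delta>_def field_simps)
  finally have \<delta>M: "\<delta> * M \<le> \<epsilon> / 2" .
  obtain C where C: "\<And>x y. 0 \<le> y \<Longrightarrow> x \<in> {0..1} \<Longrightarrow> y * x \<le> \<delta> * y powr p + C * x"
    using mult_le_powr_add[OF \<open>1 < p\<close> \<open>0 < \<delta>\<close>] by blast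
  have "((\<lambda>r. C * circle_mean (\<lambda>z. 1 - (norm (I z))\<^sup>2) r) \<longlongrightarrow> C * 0) (at_left 1)"
    by (intro tendsto_intros circle_mean_inner_tendsto I)
  then have "\<forall>\<^sub>F r in at_left 1. C * circle_mean (\<lambda>z. 1 - (norm (I z))\<^sup>2) r < \<epsilon> / 2"
    using \<open>0 < \<epsilon>\<close> by (intro order_tendstoD(2)[where y="C * 0"]) auto
  moreover have "\<forall>\<^sub>F r in at_left 1. r \<in> {0<..<1::real}"
    by (rule eventually_at_left_real) simp
  ultimately show "\<forall>\<^sub>F r in at_left 1. dist (circle_mean (\<lambda>z. G z * of_real (1 - (norm
    (I z))\<^sup>2)) r) 0 < \<epsilon>"
  proof eventually_elim
    case (elim r)
    then have r: "0 < r" "r < 1" by auto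
    have sub: "sphere 0 r \<subseteq> ball (0::complex) 1" using r by auto
    have cI: "continuous_on (sphere 0 r) I" and cG: "continuous_on (sphere 0 r) G"
      using I G sub by (auto simp: inner_function_def hardy_space_def
          intro: holomorphic_on_imp_continuous_on continuous_on_subset)
    have cD: "continuous_on (sphere 0 r) (\<lambda>z. 1 - (norm (I z))\<^sup>2)"
      by (intro continuous_intros cI)
    have cGp: "continuous_on (sphere 0 r) (\<lambda>z. norm (G z) powr p)"
      using \<open>1 < p\<close> by (intro continuous_on_norm_powr cG) auto
    have cGD: "continuous_on (sphere 0 r) (\<lambda>z. norm (G z * of_real (1 - (norm (I z))\<^sup>2)))"
      by (intro continuous_intros cG cI)
    have "norm (circle_mean (\<lambda>z. G z * of_real (1 - (norm (I z))\<^sup>2)) r)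
        \<le> circle_mean (\<lambda>z. norm (G z * of_real (1 - (norm (I z))\<^sup>2))) r"
      using r by (intro norm_circle_mean_le continuous_intros cG cI)
    also have "\<dots> \<le> circle_mean (\<lambda>z. \<delta> * norm (G z) powr p + C * (1 - (norm (I z))\<^sup>2)) r"
    proof (rule circle_mean_mono)
      fix z :: complex assume "norm z = r"
      then have "norm (I z) \<le> 1" using r by (intro norm_inner_function_le_1[OF I]) auto
      then have D: "1 - (norm (I z))\<^sup>2 \<in> {0..1}" by (simp add: power_le_one)
      then have "norm (of_real (1 - (norm (I z))\<^sup>2) :: complex) = 1 - (norm (I z))\<^sup>2"
        by (simp only: norm_of_real) simp
      then show "norm (G z * of_real (1 - (norm (I z))\<^sup>2))
        \<le> \<delta> * norm (G z) powr p + C * (1 - (norm (I z))\<^sup>2)"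
        using C[OF _ D, of "norm (G z)"] by (simp only: norm_mult) simp
    qed (rule cGD r(1) continuous_on_add continuous_on_mult_left cD cGp)+
    also have "\<dots> = \<delta> * hardy_mean p G r + C * circle_mean (\<lambda>z. 1 - (norm (I z))\<^sup>2) r"
      using r by (simp only: hardy_mean_eq_circle_mean circle_mean_add circle_mean_mult_left cGp
        cD continuous_on_mult_left)
    also have "\<delta> * hardy_mean p G r \<le> \<delta> * M"
      unfolding M_def using G \<open>1 < p\<close> r \<open>0 < \<delta>\<close>
        by (intro mult_left_mono hardy_mean_le_hardy_norm_powr) auto
    finally show ?case using elim \<delta>M by simp
  qed
qed

text \<open>Let \<open>a = I 0\<close>. The function \<open>1 - cnj a * I\<close> is the reproducing kernel at the origin of the
  orthogonal complement of \<open>I * H\<^sup>2\<close> in \<open>H\<^sup>2\<close>, and the lemma is its reproducing property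
  extended to \<open>H\<^sup>p\<close>: the pairing with \<open>1 + I * G\<close> is the same for all \<open>G\<close> in \<open>H\<^sup>p\<close>.
  The reason is that on the unit circle
  \<open>I * G * cnj (1 - cnj a * I) = (I - a) * G\<close>, which is analytic and vanishes at 0.\<close>

lemma circle_mean_kernel_tendsto:
  assumes I: "inner_function I" and G: "G \<in> hardy_space p" and "1 < p"
  shows "(circle_mean (\<lambda>z. (1 + I z * G z) * cnj (1 - cnj (I 0) * I z))
    \<longlongrightarrow> of_real (1 - (norm (I 0))\<^sup>2)) (at_left 1)"
proof -
  define a where "a = I 0"
  define D where "D = (\<lambda>z. G z * of_real (1 - (norm (I z))\<^sup>2))"
  have hI: "I holomorphic_on ball 0 1" and hG: "G holomorphic_on ball 0 1"
    using I G by (auto simp: inner_function_def hardy_space_def)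
  have "((\<lambda>r. of_real (1 - (norm a)\<^sup>2) + a * circle_mean D r)
    \<longlongrightarrow> of_real (1 - (norm a)\<^sup>2) + a * 0) (at_left 1)"
    unfolding D_def by (intro tendsto_intros circle_mean_inner_defect_tendsto[OF assms])
  moreover have "\<forall>\<^sub>F r in at_left 1. of_real (1 - (norm a)\<^sup>2) + a * circle_mean D r =
      circle_mean (\<lambda>z. (1 + I z * G z) * cnj (1 - cnj a * I z)) r"
    using eventually_at_left_real[of 0 1, simplified]
  proof eventually_elim
    case (elim r)
    then have r: "0 < r" "r < 1" by auto
    have sub: "sphere 0 r \<subseteq> ball (0::complex) 1" using r by auto
    have cI: "continuous_on (sphere 0 r) I" and cG: "continuous_on (sphere 0 r) G"
      using hI hG sub by (auto intro: holomorphic_on_imp_continuous_on continuous_on_subset)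
    have cD: "continuous_on (sphere 0 r) D"
      unfolding D_def by (intro continuous_intros cI cG)
    \<comment> \<open>The identity on the unit circle, corrected inside the disk by the defect term \<open>D\<close>.\<close>
    have expand: "(1 + I z * G z) * cnj (1 - cnj a * I z) =
        ((1 + (I z - a) * G z) - a * cnj (I z)) + a * D z" for z
    proof -
      have "of_real (1 - (norm (I z))\<^sup>2) = 1 - I z * cnj (I z)"
        using complex_norm_square[of "I z"] by simp
      then have "D z = G z * (1 - I z * cnj (I z))" by (simp only: D_def)
      then show ?thesis by (simp only:) (simp add: algebra_simps)
    qed
    have "circle_mean (\<lambda>z. 1 + (I z - a) * G z) r = 1 + (I 0 - a) * G 0"
      by (rule circle_mean_holomorphic) (use r in \<open>auto intro!: holomorphic_intros hI hG\<close>)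
    then have h1: "circle_mean (\<lambda>z. 1 + (I z - a) * G z) r = 1" by (simp add: a_def)
    have h2: "circle_mean (\<lambda>z. a * cnj (I z)) r = a * cnj a"
      using circle_mean_holomorphic[OF hI r]
        by (simp add: circle_mean_mult_left circle_mean_cnj a_def)
    have c1: "continuous_on (sphere 0 r) (\<lambda>z. 1 + (I z - a) * G z)"
      and c2: "continuous_on (sphere 0 r) (\<lambda>z. a * cnj (I z))"
      and c3: "continuous_on (sphere 0 r) (\<lambda>z. (1 + (I z - a) * G z) - a * cnj (I z))"
      and c4: "continuous_on (sphere 0 r) (\<lambda>z. a * D z)"
      by (intro continuous_intros cI cG cD)+
    have "circle_mean (\<lambda>z. (1 + I z * G z) * cnj (1 - cnj a * I z)) r
      = 1 - a * cnj a + a * circle_mean D r"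
      unfolding expand
      by (simp only: circle_mean_add[OF c3 c4 r(1)] circle_mean_diff[OF c1 c2 r(1)] h1 h2
        circle_mean_mult_left[of a D])
    moreover have "of_real (1 - (norm a)\<^sup>2) = 1 - a * cnj a"
      using complex_norm_square[of a] by simp
    ultimately show ?case by (simp only:)
  qed
  ultimately show ?thesis
    by (auto simp: a_def intro: Lim_transform_eventually)
qed

section \<open>The distance from 1 to the multiples of an inner function\<close>

text \<open>A power of the kernel is again congruent to 1 modulo \<open>I\<close>: substitute \<open>\<zeta> = I z\<close> in the
  conclusion. The disk has radius \<open>R > 1\<close> so that \<open>\<psi>\<close> is bounded on the closed unit disk,
  where the values of \<open>I\<close> lie.\<close>

lemma powr_eq_1_plus_mult:
  fixes s :: real
  assumes "norm a < 1"
  obtains \<psi> R where "1 < R" "\<psi> holomorphic_on ball 0 R"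
    "\<And>\<zeta>. \<zeta> \<in> ball 0 R \<Longrightarrow> 0 < Re (1 - cnj a * \<zeta>)"
    "\<And>\<zeta>. \<zeta> \<in> ball 0 R \<Longrightarrow> (1 - cnj a * \<zeta>) powr of_real s = 1 + \<zeta> * \<psi> \<zeta>"
proof -
  \<comment> \<open>Any \<open>R > 1\<close> with \<open>norm a * R \<le> 1\<close> keeps \<open>1 - cnj a * \<zeta>\<close> in the right half-plane,
    away from the branch cut of \<open>powr\<close>; this choice also covers \<open>a = 0\<close>.\<close>
  define R where "R = 2 / (1 + norm a)"
  have R: "1 < R" using assms norm_ge_zero[of a]
    by (simp add: R_def pos_less_divide_eq add_nonneg_pos add_pos_nonneg)
  have aR: "norm a * R \<le> 1"
    using assms by (simp add: R_def divide_le_eq add_pos_nonneg)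
  have re: "0 < Re (1 - cnj a * \<zeta>)" if "\<zeta> \<in> ball 0 R" for \<zeta>
  proof -
    have "Re (cnj a * \<zeta>) \<le> norm a * norm \<zeta>"
      using complex_Re_le_cmod[of "cnj a * \<zeta>"] by (simp add: norm_mult)
    also have "\<dots> < 1"
    proof (cases "a = 0")
      case False
      then have "norm a * norm \<zeta> < norm a * R" using that by simp
      with aR show ?thesis by simp
    qed simp
    finally show ?thesis by simp
  qed
  then have nonneg: "1 - cnj a * \<zeta> \<notin> \<real>\<^sub>\<le>\<^sub>0" if "\<zeta> \<in> ball 0 R" for \<zeta>
    using that by (auto simp only: complex_nonpos_Reals_iff dest: leD)
  define g where "g = (\<lambda>\<zeta>. (1 - cnj a * \<zeta>) powr of_real s - 1)"
  define \<psi> where "\<psi> = (\<lambda>\<zeta>. if \<zeta> = 0 then deriv g 0 else g \<zeta> / \<zeta>)"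
  have "g holomorphic_on ball 0 R"
    unfolding g_def using nonneg by (intro holomorphic_intros) auto
  then have "\<psi> holomorphic_on ball 0 R"
    by (rule pole_theorem_open_0[where a=0 and g=g]) (auto simp: \<psi>_def g_def)
  moreover have "(1 - cnj a * \<zeta>) powr of_real s = 1 + \<zeta> * \<psi> \<zeta>" for \<zeta>
    by (simp add: \<psi>_def g_def)
  ultimately show ?thesis using R re that by blast
qed

text \<open>Young's inequality for \<open>x\<close> and \<open>k powr (2 - 2 / p)\<close>, whose conjugate power is \<open>k\<^sup>2\<close>.
  Equality holds at \<open>x = k powr (2 / p)\<close>, which is what makes the distance estimate below
  sharp.\<close>

lemma Young_weighted:
  fixes x k p :: real
  assumes "1 < p" "0 \<le> x" "0 < k"
  shows "(1 - p) * k\<^sup>2 + p * (x * (k powr (1 - 2 / p) * k)) \<le> x powr p"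
proof -
  define q where "q = p / (p - 1)"
  define e where "e = 2 - 2 / p"
  have q: "1 < q" "1 / p + 1 / q = 1" using assms(1) by (auto simp: q_def field_simps)
  have eq: "e * q = 2" using assms(1) by (simp add: e_def q_def field_simps)
  have k1: "k powr (1 - 2 / p) * k = k powr e"
    using powr_add[of k "1 - 2 / p" 1] assms(3) by (simp add: e_def)
  have k2: "(k powr e) powr q = k\<^sup>2"
    using assms(3) by (simp add: powr_powr eq)
  have "x * k powr e \<le> x powr p / p + k\<^sup>2 / q"
    using Youngs_inequality[OF assms(1) q assms(2), of "k powr e"] by (simp add: k2)
  then have "p * (x * k powr e) \<le> p * (x powr p / p + k\<^sup>2 / q)"
    using assms(1) by (intro mult_left_mono) auto
  also have "\<dots> = x powr p + (p - 1) * k\<^sup>2"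
    using assms(1) by (simp add: q_def field_simps)
  finally show ?thesis by (simp only: k1) (simp add: algebra_simps)
qed

text \<open>The distance from 1 to \<open>I * H\<^sup>p\<close>. Write \<open>a = I 0\<close>, \<open>K = 1 - cnj a * I\<close> and \<open>h = 1 - I * g\<close>.
  The extremal function is \<open>K powr (2 / p)\<close>, so \<open>h\<close> is compared with it: Young's inequality
  linearises \<open>norm (h z) powr p\<close> around it and leaves the mean of
  \<open>h * K powr (1 - 2 / p) * cnj K\<close>. Since both \<open>h\<close> and \<open>K powr (1 - 2 / p)\<close> are
  congruent to 1 modulo \<open>I\<close>, so is their product, and the reproducing property of \<open>K\<close> evaluates
  the mean in the limit to \<open>1 - (norm a)\<^sup>2\<close>. The mean of \<open>(norm (K z))\<^sup>2\<close> has the same limit, and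
  the weights \<open>1 - p\<close> and \<open>p\<close> add up to 1.\<close>

lemma hardy_norm_one_minus_inner_mult_ge:
  assumes p: "1 < p" and I: "inner_function I" and g: "g \<in> hardy_space p"
  shows "1 - (norm (I 0))\<^sup>2 \<le> hardy_norm p (\<lambda>z. 1 - I z * g z) powr p"
proof (cases "norm (I 0) < 1")
  case False
  then have "1 \<le> (norm (I 0))\<^sup>2" by simp
  then show ?thesis using powr_ge_zero[of "hardy_norm p (\<lambda>z. 1 - I z * g z)" p] by linarith
next
  case True
  define a where "a = I 0"
  define s where "s = 1 - 2 / p"
  obtain \<psi> R where R: "1 < R" and h\<psi>: "\<psi> holomorphic_on ball 0 R"
    and re: "\<And>\<zeta>. \<zeta> \<in> ball 0 R \<Longrightarrow> 0 < Re (1 - cnj a * \<zeta>)"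
    and \<psi>: "\<And>\<zeta>. \<zeta> \<in> ball 0 R \<Longrightarrow> (1 - cnj a * \<zeta>) powr of_real s = 1 + \<zeta> * \<psi> \<zeta>"
    using powr_eq_1_plus_mult[of a s] True unfolding a_def by metis
  have I_R: "I z \<in> ball 0 R" if "z \<in> ball 0 1" for z
    using norm_inner_function_le_1[OF I that] R by simp
  define K where "K = (\<lambda>z. 1 - cnj a * I z)"
  define h where "h = (\<lambda>z. 1 - I z * g z)"
  \<comment> \<open>The quotient in \<open>h * K powr s = 1 + I * G\<close>. Its form avoids a division by \<open>I\<close>, so that
    membership in \<open>H\<^sup>p\<close> can be read off.\<close>
  define G where "G = (\<lambda>z. \<psi> (I z) - g z * K z powr of_real s)"
  have hI: "I holomorphic_on ball 0 1" and hg: "g holomorphic_on ball 0 1"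
    using I g by (auto simp: inner_function_def hardy_space_def)
  have KRe: "0 < Re (K z)" if "z \<in> ball 0 1" for z
    using re[OF I_R[OF that]] by (simp add: K_def)
  then have K_nonneg: "K z \<notin> \<real>\<^sub>\<le>\<^sub>0" if "z \<in> ball 0 1" for z
    using that by (auto simp only: complex_nonpos_Reals_iff dest: leD)
  have hK: "K holomorphic_on ball 0 1"
    unfolding K_def by (intro holomorphic_intros hI)
  have hKs: "(\<lambda>z. K z powr of_real s) holomorphic_on ball 0 1"
    using K_nonneg by (intro holomorphic_on_powr hK holomorphic_on_const)
  have h\<psi>I: "(\<lambda>z. \<psi> (I z)) holomorphic_on ball 0 1"
    using holomorphic_on_compose_gen[OF hI h\<psi> image_subsetI[OF I_R]] by (simp add: o_def)
  have "compact (\<psi> ` cball 0 1)"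
    using R by (intro compact_continuous_image holomorphic_on_imp_continuous_on
        holomorphic_on_subset[OF h\<psi>]) auto
  then have "bounded (\<psi> ` cball 0 1)" by (rule compact_imp_bounded)
  then obtain B where "\<forall>\<zeta>\<in>cball 0 1. norm (\<psi> \<zeta>) \<le> B"
    unfolding bounded_iff by blast
  then have B: "norm (\<psi> (I z)) \<le> B" if "z \<in> ball 0 1" for z
    using norm_inner_function_le_1[OF I that] by simp
  have Ks: "K z powr of_real s = 1 + I z * \<psi> (I z)" if "z \<in> ball 0 1" for z
    using \<psi>[OF I_R[OF that]] by (simp add: K_def)
  have Ks_le: "norm (K z powr of_real s) \<le> 1 + B" if "z \<in> ball 0 1" for z
  proof -
    have "norm (I z * \<psi> (I z)) \<le> 1 * B"
      unfolding norm_mult using norm_inner_function_le_1[OF I that] B[OF that]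
      by (intro mult_mono) auto
    then show ?thesis
      unfolding Ks[OF that] using norm_triangle_ineq[of 1 "I z * \<psi> (I z)"] by simp
  qed
  have h_hardy: "h \<in> hardy_space p"
  proof (rule hardy_space_dominated[OF _ g])
    show "h holomorphic_on ball 0 1" unfolding h_def by (intro holomorphic_intros hI hg)
    fix z :: complex assume z: "z \<in> ball 0 1"
    have "norm (I z * g z) \<le> 1 * norm (g z)"
      unfolding norm_mult using norm_inner_function_le_1[OF I z] by (intro mult_right_mono) auto
    then show "norm (h z) \<le> 1 * norm (g z) + 1"
      unfolding h_def using norm_triangle_ineq4[of 1 "I z * g z"] by simp
  qed (use p in auto)
  have G_hardy: "G \<in> hardy_space p"
  proof (rule hardy_space_dominated[OF _ g])
    show "G holomorphic_on ball 0 1" unfolding G_def by (intro holomorphic_intros h\<psi>I hg hKs)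
    fix z :: complex assume z: "z \<in> ball 0 1"
    have "norm (g z * K z powr of_real s) \<le> norm (g z) * (1 + B)"
      unfolding norm_mult using Ks_le[OF z] by (intro mult_left_mono) auto
    then show "norm (G z) \<le> (1 + B) * norm (g z) + B"
      unfolding G_def using norm_triangle_ineq4[of "\<psi> (I z)" "g z * K z powr of_real s"] B[OF z]
      by (simp add: mult.commute)
  qed (use p in auto)
  \<comment> \<open>\<open>K\<close> itself is \<open>1 + I * (- cnj a)\<close>, so the same limit theorem computes the mean of
    \<open>K * cnj K\<close>.\<close>
  have K_hardy: "(\<lambda>z. - cnj a) \<in> hardy_space p"
    by (rule hardy_space_dominated[OF _ zero_in_hardy_space, where A=0
      and B="norm a"]) (use p in auto)
  define L where "L = 1 - (norm a)\<^sup>2"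
  have "0 \<le> L" using True by (simp add: L_def a_def power_le_one)
  have hKs_eq: "h z * K z powr of_real s = 1 + I z * G z" if "z \<in> ball 0 1" for z
    using Ks[OF that] by (simp add: h_def G_def algebra_simps)

  have lim1: "(circle_mean (\<lambda>z. (1 + I z * G z) * cnj (K z)) \<longlongrightarrow> of_real L) (at_left 1)"
    using circle_mean_kernel_tendsto[OF I G_hardy p] by (simp add: K_def L_def a_def)
  have lim2: "(circle_mean (\<lambda>z. K z * cnj (K z)) \<longlongrightarrow> of_real L) (at_left 1)"
    using circle_mean_kernel_tendsto[OF I K_hardy p] by (simp add: K_def L_def a_def mult.commute)
  have "((\<lambda>r. (1 - p) * Re (circle_mean (\<lambda>z. K z * cnj (K z)) r)
          + p * norm (circle_mean (\<lambda>z. (1 + I z * G z) * cnj (K z)) r))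
        \<longlongrightarrow> (1 - p) * Re (of_real L) + p * norm (of_real L :: complex)) (at_left 1)"
    by (intro tendsto_intros lim1 lim2)
  moreover have "\<forall>\<^sub>F r in at_left 1. (1 - p) * Re (circle_mean (\<lambda>z. K z * cnj (K z)) r)
          + p * norm (circle_mean (\<lambda>z. (1 + I z * G z) * cnj (K z)) r) \<le> hardy_norm p h powr p"
    using eventually_at_left_real[of 0 1, simplified]
  proof eventually_elim
    case (elim r)
    then have r: "0 < r" "r < 1" by auto
    have sub: "sphere 0 r \<subseteq> ball (0::complex) 1" using r by auto
    have cI: "continuous_on (sphere 0 r) I" and cG: "continuous_on (sphere 0 r) G"
      and cK: "continuous_on (sphere 0 r) K" and ch: "continuous_on (sphere 0 r) h"
      using hI G_hardy h_hardy hK sub by (auto simp: hardy_space_def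
          intro: holomorphic_on_imp_continuous_on continuous_on_subset)
    have c1: "continuous_on (sphere 0 r) (\<lambda>z. (1 + I z * G z) * cnj (K z))"
      by (intro continuous_intros cI cG cK)
    have c2: "continuous_on (sphere 0 r) (\<lambda>z. norm ((1 + I z * G z) * cnj (K z)))"
      by (intro continuous_on_norm c1)
    have c3: "continuous_on (sphere 0 r) (\<lambda>z. (norm (K z))\<^sup>2)"
      by (intro continuous_intros cK)
    have "Re (circle_mean (\<lambda>z. K z * cnj (K z)) r) = circle_mean (\<lambda>z. (norm (K z))\<^sup>2) r"
      by (simp only: complex_norm_square[symmetric] circle_mean_of_real Re_complex_of_real)
    moreover have "norm (circle_mean (\<lambda>z. (1 + I z * G z) * cnj (K z)) r)
        \<le> circle_mean (\<lambda>z. norm ((1 + I z * G z) * cnj (K z))) r"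
      by (rule norm_circle_mean_le[OF c1 r(1)])
    ultimately have "(1 - p) * Re (circle_mean (\<lambda>z. K z * cnj (K z)) r)
          + p * norm (circle_mean (\<lambda>z. (1 + I z * G z) * cnj (K z)) r)
        \<le> (1 - p) * circle_mean (\<lambda>z. (norm (K z))\<^sup>2) r
          + p * circle_mean (\<lambda>z. norm ((1 + I z * G z) * cnj (K z))) r"
      using p by simp
    also have "\<dots> = circle_mean (\<lambda>z. (1 - p) * (norm (K z))\<^sup>2
        + p * norm ((1 + I z * G z) * cnj (K z))) r"
      by (simp only: circle_mean_add[OF continuous_on_mult_left[OF c3]
            continuous_on_mult_left[OF c2] r(1)]
          circle_mean_mult_left)
    also have "\<dots> \<le> circle_mean (\<lambda>z. norm (h z) powr p) r"
    proof (rule circle_mean_mono)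
      fix z :: complex assume "norm z = r"
      then have z: "z \<in> ball 0 1" using r by simp
      have "0 < norm (K z)" using KRe[OF z] by auto
      moreover have "norm ((1 + I z * G z) * cnj (K z))
        = norm (h z) * (norm (K z) powr s * norm (K z))"
        by (simp add: hKs_eq[OF z, symmetric] norm_mult norm_powr_real_powr')
      ultimately show "(1 - p) * (norm (K z))\<^sup>2 + p * norm ((1 + I z * G z) * cnj (K z))
        \<le> norm (h z) powr p"
        using Young_weighted[OF p, of "norm (h z)" "norm (K z)"] by (simp add: s_def)
    qed (use p r in \<open>auto intro!: continuous_on_add continuous_on_mult_left c2 c3
      continuous_on_norm_powr ch\<close>)
    also have "\<dots> \<le> hardy_norm p h powr p"
      using hardy_mean_le_hardy_norm_powr[OF h_hardy] p r by (simp add: hardy_mean_eq_circle_mean)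
    finally show ?case .
  qed
  ultimately have "(1 - p) * Re (of_real L) + p * norm (of_real L :: complex)
    \<le> hardy_norm p h powr p"
    using tendsto_upperbound by fastforce
  then have "L \<le> hardy_norm p h powr p" using \<open>0 \<le> L\<close> by (simp add: algebra_simps)
  then show ?thesis by (simp add: L_def a_def h_def)
qed

section \<open>The inner part of a polynomial\<close>

lemma inner_function_1: "inner_function (\<lambda>z. 1)"
  by (auto simp: inner_function_def image_constant_conv intro!: AE_I2 exI[of _ 1])

lemma inner_function_mult:
  assumes "inner_function I" "inner_function J"
  shows "inner_function (\<lambda>z. I z * J z)"
proof -
  have "bounded ((\<lambda>z. I z * J z) ` ball 0 1)"
  proof (rule boundedI)
    fix w assume "w \<in> (\<lambda>z. I z * J z) ` ball 0 1"
    then obtain z where z: "z \<in> ball 0 1" "w = I z * J z" by blast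
    then show "norm w \<le> 1"
      using assms by (simp only: norm_mult)
        (intro mult_le_one norm_inner_function_le_1 norm_ge_zero)
  qed
  moreover have "AE \<theta>\<in>{0..2*pi} in lborel.
        \<exists>\<zeta>. norm \<zeta> = 1 \<and> ((\<lambda>r. I (of_real r * cis \<theta>) * J (of_real r * cis \<theta>)) \<longlongrightarrow> \<zeta>) (at_left 1)"
    using assms[unfolded inner_function_def, THEN conjunct2, THEN conjunct2]
  proof eventually_elim
    case (elim x)
    show ?case
    proof
      assume "x \<in> {0..2*pi}"
      with elim obtain \<zeta> \<xi> where "norm \<zeta> = 1" "((\<lambda>r. I (of_real r * cis x)) \<longlongrightarrow> \<zeta>) (at_left 1)"
        "norm \<xi> = 1" "((\<lambda>r. J (of_real r * cis x)) \<longlongrightarrow> \<xi>) (at_left 1)" by blast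
      then show "\<exists>\<zeta>. norm \<zeta> = 1 \<and> ((\<lambda>r. I (of_real r * cis x) * J (of_real r * cis x))
        \<longlongrightarrow> \<zeta>) (at_left 1)"
        by (intro exI[of _ "\<zeta> * \<xi>"]) (auto intro!: tendsto_intros simp: norm_mult)
    qed
  qed
  ultimately show ?thesis
    using assms by (auto simp: inner_function_def intro!: holomorphic_intros)
qed

text \<open>The Blaschke factors: on the unit circle \<open>z - w = z * cnj (1 - cnj w * z)\<close>, so numerator and
  denominator have the same modulus there.\<close>

lemma inner_function_Moebius:
  assumes "norm w < 1"
  shows "inner_function (Moebius_function 0 w)"
proof -
  have "\<exists>\<zeta>. norm \<zeta> = 1 \<and> ((\<lambda>r. Moebius_function 0 w (of_real r * cis \<theta>)) \<longlongrightarrow> \<zeta>) (at_left 1)" for \<theta>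
  proof (intro exI conjI)
    have "cis \<theta> * cnj (cis \<theta>) = 1" by (simp add: cis_cnj cis_mult)
    then have "cis \<theta> - w = cis \<theta> * cnj (1 - cnj w * cis \<theta>)"
      by (simp add: algebra_simps)
    then have eq: "norm (cis \<theta> - w) = norm (1 - cnj w * cis \<theta>)"
      by (metis norm_mult norm_cis complex_mod_cnj mult_1)
    have ne: "1 - cnj w * cis \<theta> \<noteq> 0"
      using eq assms norm_cis[of \<theta>] by auto
    show "((\<lambda>r. Moebius_function 0 w (of_real r * cis \<theta>))
        \<longlongrightarrow> (of_real 1 * cis \<theta> - w) / (1 - cnj w * (of_real 1 * cis \<theta>))) (at_left 1)"
      unfolding Moebius_function_simple using ne by (intro tendsto_intros) auto
    show "norm ((of_real 1 * cis \<theta> - w) / (1 - cnj w * (of_real 1 * cis \<theta>))) = 1"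
      using eq ne by (simp add: norm_divide)
  qed
  moreover have "bounded (Moebius_function 0 w ` ball 0 1)"
    using Moebius_function_norm_lt_1[OF assms]
      by (intro boundedI[where B=1]) (auto intro: less_imp_le)
  ultimately show ?thesis
    using Moebius_function_holomorphic[OF assms] by (auto simp: inner_function_def)
qed

text \<open>Each root \<open>w\<close> in the disk is reflected in the circle:
  \<open>z - w\<close> is the Blaschke factor at \<open>w\<close> times \<open>1 - cnj w * z\<close>. At 0 the Blaschke
  factor has modulus \<open>norm w\<close>, so the modulus of the product of these roots is that of an
  inner function at 0. Roots on or outside the circle stay in the polynomial.\<close>

lemma prod_linear_factors_inner_decomposition:
  fixes A :: "complex multiset"
  shows "\<exists>W Q. inner_function W \<and> norm (W 0) = norm (\<Prod>w\<in>#filter_mset (\<lambda>w. norm w < 1) A. w) \<and>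
    (\<forall>z\<in>ball 0 1. poly (\<Prod>w\<in>#A. [:-w, 1:]) z = W z * poly Q z)"
proof (induction A)
  case empty
  show ?case by (intro exI[of _ "\<lambda>z. 1"] exI[of _ 1]) (simp add: inner_function_1)
next
  case (add w A)
  then obtain W Q where W: "inner_function W" "norm (W 0)
    = norm (\<Prod>w\<in>#filter_mset (\<lambda>w. norm w < 1) A. w)"
    and Q: "\<And>z. z \<in> ball 0 1 \<Longrightarrow> poly (\<Prod>w\<in>#A. [:-w, 1:]) z = W z * poly Q z" by blast
  show ?case
  proof (cases "norm w < 1")
    case True
    have ne: "1 - cnj w * z \<noteq> 0" if "z \<in> ball 0 1" for z
    proof
      assume "1 - cnj w * z = 0"
      then have "norm w * norm z = 1" by (metis complex_mod_cnj eq_iff_diff_eq_0 norm_mult norm_one)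
      moreover have "norm w * norm z < 1 * 1"
        using True that by (intro mult_strict_mono') auto
      ultimately show False by simp
    qed
    show ?thesis
    proof (intro exI conjI ballI)
      show "inner_function (\<lambda>z. W z * Moebius_function 0 w z)"
        by (rule inner_function_mult[OF W(1) inner_function_Moebius[OF True]])
      show "norm (W 0 * Moebius_function 0 w 0)
          = norm (\<Prod>w\<in>#filter_mset (\<lambda>w. norm w < 1) (add_mset w A). w)"
        using True W(2) by (simp add: norm_mult Moebius_function_simple)
      show "poly (\<Prod>w\<in>#add_mset w A. [:-w, 1:]) z
          = W z * Moebius_function 0 w z * poly ([:1, - cnj w:] * Q) z" if "z \<in> ball 0 1" for z
        using Q[OF that] ne[OF that] by (simp add: Moebius_function_simple field_simps)
    qed
  next
    case False
    show ?thesis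
    proof (intro exI conjI ballI)
      show "inner_function W" by (rule W(1))
      show "norm (W 0) = norm (\<Prod>w\<in>#filter_mset (\<lambda>w. norm w < 1) (add_mset w A). w)"
        using False W(2) by simp
      show "poly (\<Prod>w\<in>#add_mset w A. [:-w, 1:]) z = W z * poly ([:-w, 1:] * Q) z"
        if "z \<in> ball 0 1" for z
        using Q[OF that] by (simp add: algebra_simps)
    qed
  qed
qed

lemma poly_inner_decomposition:
  fixes q :: "complex poly"
  obtains W Q where "inner_function W"
    "norm (W 0) = norm (\<Prod>w\<in>#filter_mset (\<lambda>w. norm w < 1) (proots q). w)"
    "\<And>z. z \<in> ball 0 1 \<Longrightarrow> poly q z = W z * poly Q z"
proof -
  obtain W Q where "inner_function W"
    "norm (W 0) = norm (\<Prod>w\<in>#filter_mset (\<lambda>w. norm w < 1) (proots q). w)"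
    and Q: "\<And>z. z \<in> ball 0 1 \<Longrightarrow> poly (\<Prod>w\<in>#proots q. [:-w, 1:]) z = W z * poly Q z"
    using prod_linear_factors_inner_decomposition[of "proots q"] by blast
  moreover have "poly q z = W z * poly (smult (lead_coeff q) Q) z" if "z \<in> ball 0 1" for z
  proof -
    have "poly q z = lead_coeff q * poly (\<Prod>w\<in>#proots q. [:-w, 1:]) z"
      by (subst complex_poly_decompose_multiset[symmetric]) simp
    with Q[OF that] show ?thesis by simp
  qed
  ultimately show ?thesis using that by blast
qed

lemma hardy_space_poly_mult:
  assumes "F \<in> hardy_space p" "0 < p"
  shows "(\<lambda>z. poly Q z * F z) \<in> hardy_space p"
proof -
  have "compact (poly Q ` cball 0 1)" by (intro compact_continuous_image continuous_intros) auto
  then have "bounded (poly Q ` cball 0 1)" by (rule compact_imp_bounded)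
  then obtain B where B: "\<forall>z\<in>cball 0 1. norm (poly Q z) \<le> B"
    unfolding bounded_iff by blast
  have "F holomorphic_on ball 0 1" using assms by (auto simp: hardy_space_def)
  then have "(\<lambda>z. poly Q z * F z) holomorphic_on ball 0 1" by (intro holomorphic_intros)
  then show ?thesis
  proof (rule hardy_space_dominated[OF _ assms])
    show "norm (poly Q z * F z) \<le> B * norm (F z) + 0" if "z \<in> ball 0 1" for z
      using B that by (simp add: norm_mult mult_right_mono)
  qed
qed

lemma hardy_norm_cong:
  assumes "\<And>z. z \<in> ball 0 1 \<Longrightarrow> f z = g z"
  shows "hardy_norm p f = hardy_norm p g"
proof -
  have "hardy_mean p f r = hardy_mean p g r" if "r \<in> {0<..<1}" for r
    unfolding hardy_mean_eq_circle_mean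
    by (rule circle_mean_cong) (use assms that in auto)
  then show ?thesis by (simp add: hardy_norm_def)
qed

section \<open>Roots of optimal polynomial approximants\<close>

theorem proposition4p7:
  fixes p :: real and n :: nat and f J :: "complex \<Rightarrow> complex" and q :: "complex poly"
  assumes "1 < p"
    and "f \<in> hardy_space p"
    and "inner_part p f J"
    and "J 0 \<noteq> 0"
    and "optimal_poly_approximant n p f q"
  shows "norm (\<Prod>w\<in>#filter_mset (\<lambda>w. norm w < 1) (proots q). w)
           \<ge> sqrt (1 - hardy_norm p (\<lambda>z. 1 - poly q z * f z) powr p) / norm (J 0)"
proof -
  define P where "P = norm (\<Prod>w\<in>#filter_mset (\<lambda>w. norm w < 1) (proots q). w)"
  obtain F where J: "inner_function J" and F: "F \<in> hardy_space p"
    and f: "\<And>z. z \<in> ball 0 1 \<Longrightarrow> f z = J z * F z"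
    using assms(3) by (auto simp: inner_part_def)
  obtain W Q where W: "inner_function W" "norm (W 0) = P"
    and q: "\<And>z. z \<in> ball 0 1 \<Longrightarrow> poly q z = W z * poly Q z"
    unfolding P_def by (rule poly_inner_decomposition[of q]) blast
  have "1 - (norm (J 0 * W 0))\<^sup>2 \<le> hardy_norm p (\<lambda>z. 1 - J z * W z * (poly Q z * F z)) powr p"
    using assms(1) F J W(1)
    by (intro hardy_norm_one_minus_inner_mult_ge inner_function_mult hardy_space_poly_mult) auto
  also have "hardy_norm p (\<lambda>z. 1 - J z * W z * (poly Q z * F z))
    = hardy_norm p (\<lambda>z. 1 - poly q z * f z)"
    by (rule hardy_norm_cong) (simp add: q f)
  finally have "1 - hardy_norm p (\<lambda>z. 1 - poly q z * f z) powr p \<le> (norm (J 0) * P)\<^sup>2"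
    by (simp add: norm_mult W(2))
  then have "sqrt (1 - hardy_norm p (\<lambda>z. 1 - poly q z * f z) powr p) \<le> norm (J 0) * P"
    using P_def by (intro real_le_lsqrt) auto
  then show ?thesis
    unfolding P_def[symmetric] using assms(4) by (simp add: divide_le_eq mult.commute)
qed

end
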